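(* Fix an integer $m\ge2$. Let $r=r(n)$ be positive integers such that $N/r^3=o(1)$ as $n\to\infty$, where $N=\binom n2$. Then, uniformly for all $\pi\in\mathfrak S_n^m$, $$P_{G_\pi}(r)\le(1+o(1))\,r^{mN}E_{n,m,r}^2\exp\left(\frac{\operatorname{wt}(\pi)}{r-c_m}\right),$$ where $P_{G_\pi}$ is the chromatic polynomial of the auxiliary graph $G_\pi$, $E_{n,m,r}=\prod_{i=1}^{m-1}\left(1-\frac ir\right)^N$ and $c_m=\frac{2m-1}{6}$.
   Context: $\mathfrak S_n$ is the symmetric group on $[n]=\{1,\dots,n\}$, acting on $\binom{[n]}2$ by $\tau(\{u,v\})=\{\tau(u),\tau(v)\}$. Auxiliary graph: for $\pi=(\pi_1,\dots,\pi_m)\in\mathfrak S_n^m$, the simple graph $G_\pi$ has vertex set $\{\beta_k(e):k\in[m],\ e\in\binom{[n]}2\}$ ($mN$ distinct vertices). There are no edges between vertices with the same layer index $k$. For $k\ne\ell$, $\beta_k(e)$ and $\beta_\ell(e')$ are adjacent if and only if (i) $e=e'$ or (ii) $\pi_k(e)=\pi_\ell(e')$. Weight: for $1\le k<\ell\le m$ let $\tau_{k\ell}=\pi_k^{-1}\pi_\ell$, let $f_{k\ell}(\pi)$ be its number of fixed points in $[n]$ and $t_{k\ell}(\pi)$ its number of transpositions ($2$-cycles in its cycle decomposition). Set $\operatorname{wt}_{k\ell}(\pi)=\binom{f_{k\ell}(\pi)}2+t_{k\ell}(\pi)$ and $\operatorname{wt}(\pi)=\sum_{1\le k<\ell\le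 m}\operatorname{wt}_{k\ell}(\pi)$. Asymptotics are as $n\to\infty$ with $m$ fixed; "uniformly" means that the $o(1)$ term is bounded by a quantity tending to $0$ that does not depend on $\pi$. *)

theory Defs
  imports
    "HOL-Analysis.Analysis"
    "HOL-Computational_Algebra.Polynomial"
    "HOL-Combinatorics.Permutations"
    "HOL-Library.Ramsey"
begin

text \<open>A finite simple graph is given by a vertex set and a symmetric, irreflexive adjacency
  relation. Colourings are extensional functions (undefined off the vertex set), so that
  counting them is meaningful.\<close>

definition proper_colourings :: "'a set \<Rightarrow> ('a \<Rightarrow> 'a \<Rightarrow> bool) \<Rightarrow> nat \<Rightarrow> ('a \<Rightarrow> nat) set" where
  "proper_colourings V adj q =
     {c \<in> V \<rightarrow>\<^sub>E {..<q}. \<forall>u\<in>V. \<forall>v\<in>V. adj u v \<longrightarrow> c u \<noteq> c v}"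

text \<open>The unique polynomial whose value at every natural number \<open>q\<close> is the number of proper
  \<open>q\<close>-colourings; \<open>ex1_chromatic_poly\<close> below shows that the description is well-defined for
  every finite vertex set.\<close>

definition chromatic_poly :: "'a set \<Rightarrow> ('a \<Rightarrow> 'a \<Rightarrow> bool) \<Rightarrow> real poly" where
  "chromatic_poly V adj =
     (THE p. \<forall>q::nat. poly p (real q) = real (card (proper_colourings V adj q)))"

lemma card_proper_colourings_onto:
  assumes "finite S"
  shows "card {c \<in> V \<rightarrow>\<^sub>E S. (\<forall>u\<in>V. \<forall>v\<in>V. adj u v \<longrightarrow> c u \<noteq> c v) \<and> c ` V = S} =
         card {c \<in> V \<rightarrow>\<^sub>E {..<card S}. (\<forall>u\<in>V. \<forall>v\<in>V. adj u v \<longrightarrow> c u \<noteq> c v) \<and> c ` V = {..<card S}}"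
    (is "card ?A = card ?B")
proof -
  obtain h where h: "bij_betw h {..<card S} S"
    using assms ex_bij_betw_nat_finite[of S] by (auto simp: atLeast0LessThan)
  define g where "g = inv_into {..<card S} h"
  have g: "bij_betw g S {..<card S}"
    unfolding g_def by (rule bij_betw_inv_into[OF h])
  have hg: "h (g x) = x" if "x \<in> S" for x
    using h that by (auto simp: g_def bij_betw_inv_into_right)
  have gh: "g (h x) = x" if "x < card S" for x
    using h that by (auto simp: g_def bij_betw_inv_into_left)
  have hS: "h x \<in> S" if "x < card S" for x using h that by (auto simp: bij_betw_def)
  have gS: "g x < card S" if "x \<in> S" for x using g that by (auto simp: bij_betw_def)
  have injh: "h x = h y \<longleftrightarrow> x = y" if "x < card S" "y < card S" for x y
    using that gh by metis
  have injg: "g x = g y \<longleftrightarrow> x = y" if "x \<in> S" "y \<in> S" for x y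
    using that hg by metis
  have "bij_betw (\<lambda>c. restrict (g \<circ> c) V) ?A ?B"
  proof (rule bij_betw_byWitness[where f' = "\<lambda>c. restrict (h \<circ> c) V"], goal_cases)
    case 1
    show ?case
      by (auto intro!: extensionalityI[of _ V] simp: hg)
        (auto simp: hg PiE_def extensional_def fun_eq_iff Pi_iff)
  next
    case 2
    show ?case
      by (auto simp: gh PiE_def extensional_def fun_eq_iff Pi_iff)
  next
    case 3
    show ?case
    proof (rule image_subsetI)
      fix c assume c: "c \<in> ?A"
      then have cV: "\<And>v. v \<in> V \<Longrightarrow> c v \<in> S" by auto
      have "restrict (g \<circ> c) V ` V = g ` (c ` V)" by (auto simp: image_iff)
      also have "\<dots> = {..<card S}" using c g by (auto simp: bij_betw_def)
      finally show "restrict (g \<circ> c) V \<in> ?B"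
        using c cV by (auto simp: injg gS)
    qed
  next
    case 4
    show ?case
    proof (rule image_subsetI)
      fix c assume c: "c \<in> ?B"
      then have cV: "\<And>v. v \<in> V \<Longrightarrow> c v < card S" by auto
      have "restrict (h \<circ> c) V ` V = h ` (c ` V)" by (auto simp: image_iff)
      also have "\<dots> = S" using c h by (auto simp: bij_betw_def)
      finally show "restrict (h \<circ> c) V \<in> ?A"
        using c cV by (auto simp: injh hS)
    qed
  qed
  then show ?thesis by (rule bij_betw_same_card)
qed

lemma ex1_chromatic_poly:
  assumes V: "finite V"
  shows "\<exists>!p :: real poly. \<forall>q::nat. poly p (real q) = real (card (proper_colourings V adj q))"
proof (rule ex_ex1I)
  define a where "a j = card {c \<in> V \<rightarrow>\<^sub>E {..<j::nat}.
     (\<forall>u\<in>V. \<forall>v\<in>V. adj u v \<longrightarrow> c u \<noteq> c v) \<and> c ` V = {..<j}}" for j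
  have a0: "a j = 0" if "j > card V" for j
  proof -
    have "c ` V \<noteq> {..<j}" for c :: "'a \<Rightarrow> nat"
      using card_image_le[OF V, of c] that by auto
    then show ?thesis by (simp add: a_def)
  qed
  have count: "card (proper_colourings V adj q) = (\<Sum>j\<le>card V. (q choose j) * a j)" for q
  proof -
    let ?C = "\<lambda>S. {c \<in> V \<rightarrow>\<^sub>E S. (\<forall>u\<in>V. \<forall>v\<in>V. adj u v \<longrightarrow> c u \<noteq> c v) \<and> c ` V = S}"
    have "proper_colourings V adj q = (\<Union>S\<in>Pow {..<q}. ?C S)"
      by (auto simp: proper_colourings_def PiE_iff)
    also have "card \<dots> = (\<Sum>S\<in>Pow {..<q}. card (?C S))"
    proof (rule card_UN_disjoint)
      show "\<forall>S\<in>Pow {..<q}. finite (?C S)"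
      proof
        fix S assume "S \<in> Pow {..<q}"
        then have "finite S" by (auto intro: finite_subset)
        then show "finite (?C S)"
          by (intro finite_subset[OF _ finite_PiE[OF V, of "\<lambda>_. S"]]) auto
      qed
    qed auto
    also have "\<dots> = (\<Sum>S\<in>Pow {..<q}. a (card S))"
      unfolding a_def
      by (intro sum.cong refl card_proper_colourings_onto) (auto intro: finite_subset)
    also have "\<dots> = (\<Sum>j\<le>q. \<Sum>S\<in>{S\<in>Pow {..<q}. card S = j}. a (card S))"
      by (rule sum.group[symmetric])
        (auto intro: order_trans[OF card_mono[of "{..<q}"]])
    also have "\<dots> = (\<Sum>j\<le>q. (q choose j) * a j)"
    proof (intro sum.cong refl)
      fix j
      have "(\<Sum>S\<in>{S\<in>Pow {..<q}. card S = j}. a (card S)) = card {S\<in>Pow {..<q}. card S = j} * a j"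
        by simp
      also have "card {S\<in>Pow {..<q}. card S = j} = q choose j"
        using n_subsets[of "{..<q}" j] by simp
      finally show "(\<Sum>S\<in>{S\<in>Pow {..<q}. card S = j}. a (card S)) = (q choose j) * a j" .
    qed
    also have "\<dots> = (\<Sum>j\<le>max q (card V). (q choose j) * a j)"
      by (rule sum.mono_neutral_left) (auto simp: binomial_eq_0)
    also have "\<dots> = (\<Sum>j\<le>card V. (q choose j) * a j)"
      by (rule sum.mono_neutral_right) (auto simp: a0)
    finally show ?thesis .
  qed
  define P where "P = (\<Sum>j\<le>card V. smult (real (a j) / fact j) (\<Prod>i=0..<j. [:- real i, 1:]))"
  have "poly P (real q) = real (card (proper_colourings V adj q))" for q
    by (simp add: P_def poly_sum poly_prod count binomial_gbinomial gbinomial_prod_rev mult.commute)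
  then show "\<exists>p. \<forall>q. poly p (real q) = real (card (proper_colourings V adj q))" by blast
next
  fix p p' :: "real poly"
  assume p: "\<forall>q. poly p (real q) = real (card (proper_colourings V adj q))"
    and p': "\<forall>q. poly p' (real q) = real (card (proper_colourings V adj q))"
  show "p = p'"
  proof (rule ccontr)
    assume "p \<noteq> p'"
    then have "finite {x. poly (p - p') x = 0}" by (intro poly_roots_finite) simp
    moreover have "range real \<subseteq> {x. poly (p - p') x = 0}" using p p' by auto
    ultimately have "finite (range real)" by (rule rev_finite_subset)
    then show False by (simp add: finite_image_iff inj_on_def)
  qed
qed

lemma poly_chromatic_poly:
  assumes "finite V"
  shows "poly (chromatic_poly V adj) (real q) = real (card (proper_colourings V adj q))"
  using theI'[OF ex1_chromatic_poly[OF assms, of adj]] unfolding chromatic_poly_def by blast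

text \<open>\<open>nsets {1..n} 2\<close> is the set of 2-element subsets of \<open>[n]\<close>, on which a permutation \<open>\<tau>\<close> acts
  by \<open>e \<mapsto> \<tau> ` e\<close>. The vertex \<open>\<beta>\<^sub>k(e)\<close> is encoded as the pair \<open>(k, e)\<close>.\<close>

definition perm_tuples :: "nat \<Rightarrow> nat \<Rightarrow> (nat \<Rightarrow> nat \<Rightarrow> nat) set" where
  "perm_tuples n m = {1..m} \<rightarrow>\<^sub>E {\<sigma>. \<sigma> permutes {1..n}}"

definition aux_vertices :: "nat \<Rightarrow> nat \<Rightarrow> (nat \<times> nat set) set" where
  "aux_vertices n m = {1..m} \<times> nsets {1..n} 2"

definition aux_adj :: "(nat \<Rightarrow> nat \<Rightarrow> nat) \<Rightarrow> nat \<times> nat set \<Rightarrow> nat \<times> nat set \<Rightarrow> bool" where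
  "aux_adj \<pi> = (\<lambda>(k, e) (l, e'). k \<noteq> l \<and> (e = e' \<or> \<pi> k ` e = \<pi> l ` e'))"

lemma finite_aux_vertices: "finite (aux_vertices n m)"
  by (simp add: aux_vertices_def finite_imp_finite_nsets)

lemma aux_adj_sym: "aux_adj \<pi> u v \<Longrightarrow> aux_adj \<pi> v u"
  by (auto simp: aux_adj_def)

lemma aux_adj_irrefl: "\<not> aux_adj \<pi> v v"
  by (auto simp: aux_adj_def)

definition fixpts :: "nat \<Rightarrow> (nat \<Rightarrow> nat) \<Rightarrow> nat" where
  "fixpts n \<tau> = card {x \<in> {1..n}. \<tau> x = x}"

text \<open>The 2-cycle \<open>(u v)\<close> is counted through its support \<open>{u, v}\<close>.\<close>

definition two_cycles :: "nat \<Rightarrow> (nat \<Rightarrow> nat) \<Rightarrow> nat" where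
  "two_cycles n \<tau> =
     card {{u, v} | u v. u \<in> {1..n} \<and> v \<in> {1..n} \<and> u \<noteq> v \<and> \<tau> u = v \<and> \<tau> v = u}"

definition wt_pair :: "nat \<Rightarrow> (nat \<Rightarrow> nat \<Rightarrow> nat) \<Rightarrow> nat \<Rightarrow> nat \<Rightarrow> nat" where
  "wt_pair n \<pi> k l =
     (let \<tau> = inv (\<pi> k) \<circ> \<pi> l in (fixpts n \<tau> choose 2) + two_cycles n \<tau>)"

definition wt :: "nat \<Rightarrow> nat \<Rightarrow> (nat \<Rightarrow> nat \<Rightarrow> nat) \<Rightarrow> nat" where
  "wt n m \<pi> = (\<Sum>k\<in>{1..m}. \<Sum>l\<in>{k<..m}. wt_pair n \<pi> k l)"

definition E_const :: "nat \<Rightarrow> nat \<Rightarrow> nat \<Rightarrow> real" where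
  "E_const n m r = (\<Prod>i=1..m-1. (1 - real i / real r) ^ (n choose 2))"

definition c_const :: "nat \<Rightarrow> real" where
  "c_const m = (2 * real m - 1) / 6"

end

theory Submission
  imports Defs
begin

text \<open>
  The chromatic polynomial at \<open>q\<close> is estimated by adding the vertices of a graph one at a time.
  If \<open>v\<close> is joined to a set \<open>N\<close> of \<open>d\<close> vertices that span \<open>t\<close> edges, a proper colouring \<open>c\<close> of the
  smaller graph has \<open>q - card (c ` N)\<close> extensions, and \<open>card (c ` N)\<close> is at least \<open>d\<close> minus the number
  of pairs in \<open>N\<close> that receive equal colours. Only the \<open>(d choose 2) - t\<close> non-adjacent pairs can do so,
  and each of them does so in at most a fraction \<open>1 / (q - D)\<close> of all proper colourings, where \<open>D\<close>
  bounds the degrees: recolour one of its ends. So a vertex contributes on average at most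
  \<open>q - d + ((d choose 2) - t) / (q - D)\<close>, and the logarithm of this over \<open>q\<close> is
  \<open>- d / q - (d / 2 + t) / q^2\<close> up to \<open>O(1 / q^3)\<close>. Summation over the vertices turns \<open>d\<close> into
  the number of edges and \<open>t\<close> into the number of triangles (\<open>card_proper_colourings_le_exp\<close>).

  In the auxiliary graph the vertices \<open>(k, e)\<close> with a common \<open>e\<close> form a clique of size \<open>m\<close>, and so do
  those with a common \<open>\<pi> k ` e\<close>. If these two families shared no edge, there would be
  \<open>2 N (m choose 2)\<close> edges and at least \<open>2 N (m choose 3)\<close> triangles, where \<open>N = (n choose 2)\<close>. With
  these numbers as \<open>d\<close> and \<open>t\<close>, the exponent \<open>- d / r - (d / 2 + t) / r^2\<close> is the second-order expansion
  of \<open>2 ln E\<close>, where \<open>E\<close> is \<open>E_const n m r\<close>: the sum of \<open>i\<close> over \<open>i < m\<close> is \<open>m choose 2\<close>, and that of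
  \<open>i^2\<close> is \<open>(m choose 2) + 2 (m choose 3)\<close>.
  A pair of layers \<open>k < l\<close> and an \<open>e\<close> with \<open>\<pi> k ` e = \<pi> l ` e\<close> give an edge of both families; there are
  at most \<open>wt\<close> of them. Each lies in at most \<open>m - 2\<close> shared triangles, and a shared triangle has three
  such edges, so at most \<open>(m - 2) wt / 3\<close> triangles are lost (\<open>card_coincidences_Suc_le\<close>). The resulting
  increase of the exponent is at most \<open>wt / r + c wt / r^2\<close> with \<open>c = 1 / 2 + (m - 2) / 3 = (2 m - 1) / 6\<close>,
  hence at most \<open>wt / (r - c)\<close>. The remaining errors are at most
  \<open>N / r^3\<close> times a constant that depends on \<open>m\<close> alone.
\<close>

section \<open>Counting cliques vertex by vertex\<close>

definition cliques :: "('a \<Rightarrow> 'a \<Rightarrow> bool) \<Rightarrow> nat \<Rightarrow> 'a set \<Rightarrow> 'a set set" where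
  "cliques adj j A = {S \<in> nsets A j. \<forall>u\<in>S. \<forall>v\<in>S. u \<noteq> v \<longrightarrow> adj u v}"

lemma finite_cliques: "finite A \<Longrightarrow> finite (cliques adj j A)"
  by (simp add: cliques_def finite_imp_finite_nsets)

lemma card_cliques_le: "finite A \<Longrightarrow> card (cliques adj j A) \<le> card A choose j"
  unfolding cliques_def card_nsets[symmetric]
  by (intro card_mono) (auto simp: finite_imp_finite_nsets)

lemma card_cliques_1: "card (cliques adj 1 A) = card A"
proof -
  have "cliques adj 1 A = (\<lambda>x. {x}) ` A"
    by (auto simp: cliques_def nsets_def card_1_singleton_iff)
  then show ?thesis by (simp add: card_image inj_on_def)
qed

text \<open>A clique that contains the new vertex is that vertex together with a clique of its neighbourhood;
  for \<open>j = 1\<close> and \<open>j = 2\<close> these are the increments of the numbers of edges and triangles.\<close>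

lemma card_cliques_insert:
  assumes "finite V" "v \<notin> V" "symp adj"
  shows "card (cliques adj (Suc j) (insert v V)) =
         card (cliques adj (Suc j) V) + card (cliques adj j {w \<in> V. adj v w})"
proof -
  let ?N = "{w \<in> V. adj v w}"
  have split: "cliques adj (Suc j) (insert v V) = cliques adj (Suc j) V \<union> insert v ` cliques adj j ?N"
    (is "?L = ?R")
  proof (intro set_eqI iffI)
    fix S assume S: "S \<in> ?L"
    show "S \<in> ?R"
    proof (cases "v \<in> S")
      case True
      have "S - {v} \<in> cliques adj j ?N"
        using S True by (auto simp: cliques_def nsets_def)
      then show ?thesis using True by (intro UnI2 image_eqI[of _ _ "S - {v}"]) auto
    next
      case False
      then show ?thesis using S by (auto simp: cliques_def nsets_def)
    qed
  next
    fix S assume "S \<in> ?R"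
    then show "S \<in> ?L"
      using assms by (auto simp: cliques_def nsets_def card_insert_if dest: sympD)
  qed
  have disj: "cliques adj (Suc j) V \<inter> insert v ` cliques adj j ?N = {}"
    using assms(2) by (auto simp: cliques_def nsets_def)
  have inj: "inj_on (insert v) (cliques adj j ?N)"
  proof (rule inj_onI)
    fix S T assume *: "S \<in> cliques adj j ?N" "T \<in> cliques adj j ?N" "insert v S = insert v T"
    then have "v \<notin> S" "v \<notin> T" using assms(2) by (auto simp: cliques_def nsets_def)
    then show "S = T" using *(3) by (simp add: insert_ident)
  qed
  show ?thesis
    unfolding split using assms(1) disj
    by (subst card_Un_disjoint) (auto simp: finite_cliques card_image[OF inj])
qed

section \<open>Extending a proper colouring by one vertex\<close>

lemma finite_proper_colourings: "finite V \<Longrightarrow> finite (proper_colourings V adj q)"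
  unfolding proper_colourings_def
  by (rule finite_subset[of _ "V \<rightarrow>\<^sub>E {..<q}"]) (auto intro: finite_PiE)

lemma proper_colourings_insert_bij:
  assumes "v \<notin> V" "symp adj" "irreflp adj"
  shows "bij_betw (\<lambda>(c, a). c(v := a))
           (SIGMA c:proper_colourings V adj q. {..<q} - c ` {w \<in> V. adj v w})
           (proper_colourings (insert v V) adj q)"
proof (rule bij_betw_byWitness[where f' = "\<lambda>c. (c(v := undefined), c v)"], goal_cases)
  case 1
  show ?case using assms(1) by (auto simp: proper_colourings_def PiE_def extensional_def fun_eq_iff)
next
  case 2
  show ?case by auto
next
  case 3
  show ?case
  proof (rule image_subsetI, clarify)
    fix c a
    assume c: "c \<in> proper_colourings V adj q" and a: "a < q" "a \<notin> c ` {w \<in> V. adj v w}"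
    have "a \<noteq> c w" if "w \<in> V" "adj v w \<or> adj w v" for w
      using that a(2) sympD[OF assms(2)] by blast
    moreover have "\<not> adj v v" using assms(3) by (simp add: irreflp_def)
    ultimately show "c(v := a) \<in> proper_colourings (insert v V) adj q"
      using c a(1) by (auto simp: proper_colourings_def PiE_def extensional_def Pi_iff)
  qed
next
  case 4
  show ?case
  proof (rule image_subsetI)
    fix c assume c: "c \<in> proper_colourings (insert v V) adj q"
    have *: "(c(v := undefined)) w = c w" if "w \<in> V" for w using that assms(1) by auto
    have "c(v := undefined) \<in> proper_colourings V adj q"
      using c assms(1) by (auto simp: proper_colourings_def * PiE_def Pi_iff extensional_def
          simp del: fun_upd_apply) (auto simp: fun_upd_def)
    moreover have "c v \<notin> c(v := undefined) ` {w \<in> V. adj v w}"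
      using c by (auto simp: proper_colourings_def * simp del: fun_upd_apply)
    moreover have "c v < q" using c by (auto simp: proper_colourings_def)
    ultimately show "(c(v := undefined), c v) \<in>
        (SIGMA c:proper_colourings V adj q. {..<q} - c ` {w \<in> V. adj v w})"
      by simp
  qed
qed

text \<open>Fibres of sizes \<open>a\<^sub>1, \<dots>, a\<^sub>k\<close> exceed the image by the sum of the \<open>a\<^sub>i - 1\<close>, which is at most
  the sum of the \<open>a\<^sub>i choose 2\<close>. This truncated inclusion-exclusion costs only a term of third order
  when \<open>f\<close> is a random colouring.\<close>

lemma card_le_card_image_plus_collisions:
  assumes "finite A"
  shows "card A \<le> card (f ` A) + card {S \<in> nsets A 2. \<exists>y. \<forall>u\<in>S. f u = y}"
  using assms
proof (induction A)
  case empty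
  then show ?case by simp
next
  case (insert a A)
  let ?M = "\<lambda>A. {S \<in> nsets A 2. \<exists>y. \<forall>u\<in>S. f u = y}"
  have fin: "finite (?M (insert a A))"
    using insert.hyps by (simp add: finite_imp_finite_nsets)
  have sub: "?M A \<subseteq> ?M (insert a A)" by (auto simp: nsets_def)
  show ?case
  proof (cases "f a \<in> f ` A")
    case False
    then show ?thesis using insert card_mono[OF fin sub] by simp
  next
    case True
    then obtain w where w: "w \<in> A" "f w = f a" by auto
    have "{a, w} \<in> ?M (insert a A) - ?M A"
      using w insert.hyps by (auto simp: nsets_def card_insert_if)
    then have "?M A \<subset> ?M (insert a A)" using sub by blast
    then have "card (?M A) < card (?M (insert a A))" by (rule psubset_card_mono[OF fin])
    then show ?thesis using insert True by (simp add: insert_absorb)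
  qed
qed

text \<open>Recolouring \<open>u\<close> with any colour absent from its neighbours gives at least \<open>q - D\<close> proper colourings
  from each colouring with \<open>c u = c w\<close>. No proper colouring arises twice: it determines \<open>c\<close> off \<open>u\<close>,
  and \<open>c u\<close> is recovered as the colour of \<open>w\<close>.\<close>

lemma card_coincident_colourings_le:
  fixes adj :: "'a \<Rightarrow> 'a \<Rightarrow> bool"
  assumes "finite V" "u \<in> V" "w \<in> V" "u \<noteq> w" "symp adj" "irreflp adj"
    and deg: "card {x \<in> V. adj u x} \<le> D"
  shows "card {c \<in> proper_colourings V adj q. c u = c w} * (q - D)
         \<le> card (proper_colourings V adj q)"
proof -
  let ?P = "proper_colourings V adj q"
  let ?M = "{c \<in> ?P. c u = c w}"
  let ?F = "\<lambda>c :: 'a \<Rightarrow> nat. {..<q} - c ` {x \<in> V. adj u x}"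
  have finP: "finite ?P" by (rule finite_proper_colourings[OF assms(1)])
  have "card ?M * (q - D) = (\<Sum>c\<in>?M. q - D)" by simp
  also have "\<dots> \<le> (\<Sum>c\<in>?M. card (?F c))"
  proof (rule sum_mono)
    fix c :: "'a \<Rightarrow> nat"
    have "card (c ` {x \<in> V. adj u x}) \<le> D"
      using card_image_le[of "{x \<in> V. adj u x}" c] assms(1) deg by simp
    then show "q - D \<le> card (?F c)"
      using diff_card_le_card_Diff[of "c ` {x \<in> V. adj u x}" "{..<q}"] assms(1) by simp
  qed
  also have "\<dots> = card (Sigma ?M ?F)"
    using finP by (subst card_SigmaI) auto
  also have "\<dots> \<le> card ?P"
  proof (rule card_inj_on_le[of "\<lambda>(c, a). c(u := a)"])
    show "inj_on (\<lambda>(c, a). c(u := a)) (Sigma ?M ?F)"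
    proof (rule inj_onI, clarify)
      fix c a and c' :: "'a \<Rightarrow> nat" and a'
      assume eq: "c u = c w" "c' u = c' w" "c(u := a) = c'(u := a')"
      have "c x = c' x" if "x \<noteq> u" for x using fun_cong[OF eq(3), of x] that by simp
      then have "c = c'" using eq(1,2) assms(4) by (metis ext)
      then show "c = c' \<and> a = a'" using fun_cong[OF eq(3), of u] by simp
    qed
    show "(\<lambda>(c, a). c(u := a)) ` Sigma ?M ?F \<subseteq> ?P"
    proof (rule image_subsetI, clarify)
      fix c a
      assume c: "c \<in> ?P" and a: "a < q" "a \<notin> c ` {x \<in> V. adj u x}"
      have "a \<noteq> c x" if "x \<in> V" "adj u x \<or> adj x u" for x
        using that a(2) sympD[OF assms(5)] by blast
      moreover have "\<not> adj u u" using assms(6) by (simp add: irreflp_def)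
      ultimately show "c(u := a) \<in> ?P"
        using c a(1) assms(2) by (auto simp: proper_colourings_def PiE_def extensional_def Pi_iff)
    qed
  qed (rule finP)
  finally show ?thesis .
qed

text \<open>The first-order loss \<open>card N\<close> is corrected by the pairs of neighbours that share a colour, each
  non-adjacent pair having probability at most \<open>1 / (q - D)\<close> and each adjacent pair probability \<open>0\<close>.\<close>

lemma card_proper_colourings_insert_le:
  fixes adj :: "'a \<Rightarrow> 'a \<Rightarrow> bool" and q D :: nat
  assumes fin: "finite V" and v: "v \<notin> V" and sym: "symp adj" and irr: "irreflp adj"
    and deg: "\<And>u. u \<in> insert v V \<Longrightarrow> card {x \<in> V. adj u x} \<le> D" and q: "D < q"
  defines "N \<equiv> {w \<in> V. adj v w}"
  shows "real (card (proper_colourings (insert v V) adj q)) \<le>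
    real (card (proper_colourings V adj q)) * (real q - real (card N)
      + (real (card N choose 2) - real (card (cliques adj 2 N))) / (real q - real D))"
proof -
  let ?P = "proper_colourings V adj q"
  let ?B = "nsets N 2 - cliques adj 2 N"
  have finP: "finite ?P" by (rule finite_proper_colourings[OF fin])
  have finN: "finite N" using fin by (simp add: N_def)
  have finB: "finite ?B" using finN by (simp add: finite_imp_finite_nsets)
  have cardB: "real (card ?B) = real (card N choose 2) - real (card (cliques adj 2 N))"
    using card_cliques_le[OF finN, of adj 2] finite_cliques[OF finN, of adj 2]
    by (subst card_Diff_subset) (auto simp: of_nat_diff card_nsets cliques_def)
  let ?mono = "\<lambda>c::'a \<Rightarrow> nat. \<lambda>S. \<exists>y. \<forall>u\<in>S. c u = y"
  have free: "real (card ({..<q} - c ` N)) \<le> real q - real (card N) + real (card {S \<in> ?B. ?mono c S})"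
    if c: "c \<in> ?P" for c
  proof -
    have "{S \<in> nsets N 2. ?mono c S} \<subseteq> {S \<in> ?B. ?mono c S}"
    proof (clarify, intro conjI)
      fix S y assume S: "S \<in> nsets N 2" and y: "\<forall>u\<in>S. c u = y"
      obtain a b where ab: "S = {a, b}" "a \<noteq> b" using S by (auto simp: nsets_def card_2_iff)
      have inV: "a \<in> V" "b \<in> V" using S ab by (auto simp: nsets_def N_def)
      have "\<not> adj a b"
        using c y inV unfolding ab(1) proper_colourings_def by fastforce
      then show "S \<in> ?B" using S ab by (auto simp: cliques_def)
    qed auto
    then have "card {S \<in> nsets N 2. ?mono c S} \<le> card {S \<in> ?B. ?mono c S}"
      by (rule card_mono[rotated]) (rule finite_subset[OF _ finB], auto)
    then have "card N \<le> card (c ` N) + card {S \<in> ?B. ?mono c S}"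
      using card_le_card_image_plus_collisions[OF finN, of c] by linarith
    moreover have cN: "c ` N \<subseteq> {..<q}" using c by (auto simp: proper_colourings_def N_def)
    then have "card ({..<q} - c ` N) = q - card (c ` N)"
      using finN by (subst card_Diff_subset) auto
    moreover have "card (c ` N) \<le> q" using card_mono[OF _ cN] by simp
    ultimately show ?thesis by (simp add: of_nat_diff)
  qed
  have pair: "real (card {c \<in> ?P. ?mono c S}) \<le> real (card ?P) / (real q - real D)"
    if S: "S \<in> ?B" for S
  proof -
    obtain a b where ab: "S = {a, b}" "a \<noteq> b" using S by (auto simp: nsets_def card_2_iff)
    have inV: "a \<in> V" "b \<in> V" using S ab by (auto simp: nsets_def N_def)
    have "{c \<in> ?P. ?mono c S} = {c \<in> ?P. c a = c b}" using ab by auto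
    then have "real (card {c \<in> ?P. ?mono c S} * (q - D)) \<le> real (card ?P)"
      using card_coincident_colourings_le[OF fin inV ab(2) sym irr deg, of q] inV(1)
      unfolding of_nat_le_iff by simp
    then show ?thesis using q by (simp add: of_nat_diff field_simps)
  qed
  have "real (card (proper_colourings (insert v V) adj q)) = (\<Sum>c\<in>?P. real (card ({..<q} - c ` N)))"
    using bij_betw_same_card[OF proper_colourings_insert_bij[OF v sym irr, of q]] finP
    by (simp add: N_def flip: of_nat_sum)
  also have "\<dots> \<le> (\<Sum>c\<in>?P. real q - real (card N) + real (card {S \<in> ?B. ?mono c S}))"
    by (intro sum_mono free)
  also have "\<dots> = real (card ?P) * (real q - real (card N)) + real (\<Sum>c\<in>?P. card {S \<in> ?B. ?mono c S})"
    by (simp add: sum.distrib)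
  also have "(\<Sum>c\<in>?P. card {S \<in> ?B. ?mono c S}) = (\<Sum>S\<in>?B. card {c \<in> ?P. ?mono c S})"
    using sum_multicount_gen[OF finP finB, of ?mono "\<lambda>S. card {c \<in> ?P. ?mono c S}"] by blast
  also have "real (\<Sum>S\<in>?B. card {c \<in> ?P. ?mono c S}) \<le> (\<Sum>S\<in>?B. real (card ?P) / (real q - real D))"
    unfolding of_nat_sum by (intro sum_mono pair)
  finally show ?thesis unfolding sum_constant cardB by (simp add: algebra_simps diff_divide_distrib)
qed

section \<open>The chromatic polynomial to third order\<close>

lemma exp_minus_ge_cubic:
  fixes x :: real
  shows "1 - x + x\<^sup>2 / 2 - x ^ 3 / 6 \<le> exp (- x)"
proof -
  obtain t where "exp (- x) = (\<Sum>i<4. (- x) ^ i / fact i) + exp t / fact 4 * (- x) ^ 4"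
    using Maclaurin_exp_le[of "- x" 4] by blast
  moreover have "(\<Sum>i<4. (- x) ^ i / fact i) = 1 - x + x\<^sup>2 / 2 - x ^ 3 / 6"
    by (simp add: eval_nat_numeral fact_numeral)
  ultimately show ?thesis by simp
qed

lemma exp_minus_cubic_le_one_minus:
  fixes x :: real
  assumes "0 \<le> x" "x \<le> 1 / 2"
  shows "exp (- (x + x\<^sup>2 / 2 + x ^ 3)) \<le> 1 - x"
proof -
  have "\<exists>d. ((\<lambda>x. ln (1 - x) + x + x\<^sup>2 / 2 + x ^ 3) has_real_derivative d) (at y) \<and> 0 \<le> d"
    if y: "0 \<le> y" "y \<le> x" for y
  proof (intro exI conjI)
    show "((\<lambda>x. ln (1 - x) + x + x\<^sup>2 / 2 + x ^ 3) has_real_derivative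
        y\<^sup>2 * (2 - 3 * y) / (1 - y)) (at y)"
      using y assms
      by (auto intro!: derivative_eq_intros simp: field_simps power2_eq_square power3_eq_cube)
    show "0 \<le> y\<^sup>2 * (2 - 3 * y) / (1 - y)" using y assms by simp
  qed
  then have "ln (1 - 0) + 0 + 0\<^sup>2 / 2 + 0 ^ 3 \<le> ln (1 - x) + x + x\<^sup>2 / 2 + x ^ 3"
    by (rule DERIV_nonneg_imp_nondecreasing[OF assms(1)])
  then have "- (x + x\<^sup>2 / 2 + x ^ 3) \<le> ln (1 - x)" by simp
  then show ?thesis using assms by (simp add: ln_ge_iff)
qed

text \<open>With \<open>x = d / q\<close> the left side over \<open>q\<close> is \<open>1 - x + x^2 / 2 - (d / 2 + t) / q^2 + O(D^3 / q^3)\<close>,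
  because \<open>d choose 2\<close> is \<open>d^2 / 2 - d / 2\<close>; its first three terms agree with \<open>exp (- x)\<close> to second
  order.\<close>

lemma vertex_factor_le_exp:
  fixes q d t D :: nat
  assumes "d \<le> D" "t \<le> d choose 2" "2 * D \<le> q" "0 < q"
  shows "real q - real d + (real (d choose 2) - real t) / (real q - real D) \<le>
    real q * exp (- (real d / real q) - (real d / 2 + real t) / (real q)\<^sup>2 + 7 * real D ^ 3 / real q ^ 3)"
proof -
  define x where "x = real d / q"
  define s where "s = (real d / 2 + real t) / (real q)\<^sup>2"
  define \<delta> where "\<delta> = x ^ 3 / 6 + 2 * real D ^ 3 / real q ^ 3"
  have q: "0 < real q" and Dq: "0 < real q - real D" "2 * real D \<le> real q" and dD: "real d \<le> real D"
    using assms by auto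
  have x: "0 \<le> x" "x \<le> 1" using q dD Dq by (auto simp: x_def)
  have s: "0 \<le> s" by (simp add: s_def)
  have dx: "0 \<le> \<delta>" using x by (simp add: \<delta>_def)
  have choose: "real (d choose 2) = real d * (real d - 1) / 2"
    by (cases d) (simp_all add: choose_two real_of_nat_div algebra_simps)
  define p where "p = real (d choose 2) - real t"
  have p: "0 \<le> p" "p \<le> real D ^ 2"
  proof -
    show "0 \<le> p" using assms(2) by (simp add: p_def)
    have "real d * (real d - 1) \<le> real d * real d" "0 \<le> real d * real d" "0 \<le> real t"
      by (auto intro: mult_left_mono)
    then have "p \<le> real d * real d" unfolding p_def choose by linarith
    also have "\<dots> \<le> real D ^ 2" unfolding power2_eq_square using dD by (intro mult_mono) auto
    finally show "p \<le> real D ^ 2" .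
  qed
  have "p / (real q - real D) \<le> p / real q + 2 * real D ^ 3 / (real q)\<^sup>2"
  proof -
    have "p / (real q - real D) = p / real q + p * real D / (real q * (real q - real D))"
      using q Dq by (simp add: field_simps)
    also have "p * real D / (real q * (real q - real D)) \<le> real D ^ 2 * real D / (real q * (real q / 2))"
      using p q Dq by (intro frac_le mult_mono mult_left_mono) auto
    finally show ?thesis by (simp add: power2_eq_square power3_eq_cube field_simps)
  qed
  then have "real q - real d + p / (real q - real D) \<le>
      real q - real d + (p / real q + 2 * real D ^ 3 / (real q)\<^sup>2)" by simp
  also have "\<dots> = real q * (1 - x + x\<^sup>2 / 2 - x ^ 3 / 6 - s + \<delta>)"
    using q unfolding p_def choose x_def s_def \<delta>_def
    by (simp add: field_simps power2_eq_square power3_eq_cube)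
  \<comment> \<open>As \<open>0 \<le> x \<le> 1\<close>, the factor \<open>exp (- x)\<close> lies between \<open>1 / 3\<close> and \<open>1\<close>; it may thus be attached to \<open>- s\<close>
    for free and to \<open>\<delta>\<close> at the price of a factor \<open>3\<close>.\<close>
  also have "\<dots> \<le> real q * (exp (- x) * (1 + (- s + \<delta> * 3)))"
  proof (intro mult_left_mono)
    have "s * exp (- x) \<le> s" using s x by (simp add: mult_left_le)
    moreover have "\<delta> \<le> \<delta> * 3 * exp (- x)"
    proof -
      have "exp x \<le> 3" using x exp_le order_trans[of "exp x" "exp 1" 3] by simp
      then have "1 \<le> 3 * exp (- x)" by (simp add: exp_minus field_simps)
      then show ?thesis using mult_left_mono[of 1 "3 * exp (- x)" \<delta>] dx by (simp add: mult.assoc)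
    qed
    ultimately show "1 - x + x\<^sup>2 / 2 - x ^ 3 / 6 - s + \<delta> \<le> exp (- x) * (1 + (- s + \<delta> * 3))"
      using exp_minus_ge_cubic[of x] by (simp add: algebra_simps)
  qed (use q in simp)
  also have "\<dots> \<le> real q * (exp (- x) * exp (- s + \<delta> * 3))"
    using q by (intro mult_left_mono exp_ge_add_one_self) auto
  also have "\<dots> = real q * exp (- x - s + \<delta> * 3)" by (simp flip: exp_add)
  also have "\<dots> \<le> real q * exp (- x - s + 7 * real D ^ 3 / real q ^ 3)"
  proof -
    have "x ^ 3 \<le> real D ^ 3 / real q ^ 3"
      unfolding x_def power_divide using dD by (intro divide_right_mono power_mono) auto
    then have "\<delta> * 3 \<le> 7 * (real D ^ 3 / real q ^ 3)"
      using zero_le_power[OF x(1), of 3] unfolding \<delta>_def by argo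
    then have "\<delta> * 3 \<le> 7 * real D ^ 3 / real q ^ 3" by simp
    then show ?thesis using q by simp
  qed
  finally show ?thesis by (simp add: p_def x_def s_def)
qed

text \<open>The increments of the numbers of edges and triangles caused by a new vertex are exactly the \<open>d\<close> and
  \<open>t\<close> in its factor, so the one-vertex bounds telescope.\<close>

theorem card_proper_colourings_le_exp:
  fixes adj :: "'a \<Rightarrow> 'a \<Rightarrow> bool" and q D :: nat
  assumes "finite V" and sym: "symp adj" and irr: "irreflp adj"
    and deg: "\<And>u. u \<in> V \<Longrightarrow> card {x \<in> V. adj u x} \<le> D" and q: "2 * D \<le> q" "0 < q"
  shows "real (card (proper_colourings V adj q)) \<le> real q ^ card V *
    exp (- (real (card (cliques adj 2 V)) / real q)
         - (real (card (cliques adj 2 V)) / 2 + real (card (cliques adj 3 V))) / (real q)\<^sup>2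
         + 7 * real D ^ 3 * real (card V) / real q ^ 3)"
  using assms(1) deg
proof (induction V)
  case empty
  have "cliques adj 2 {} = {}" "cliques adj 3 {} = {}"
    by (auto simp: cliques_def nsets_def)
  then show ?case by (simp add: proper_colourings_def)
next
  case (insert v V)
  define N where "N = {w \<in> V. adj v w}"
  have deg': "card {x \<in> V. adj u x} \<le> D" if "u \<in> insert v V" for u
    using insert.prems[OF that] insert.hyps(1)
      card_mono[of "{x \<in> insert v V. adj u x}" "{x \<in> V. adj u x}"]
    by (auto intro: order_trans)
  have finN: "finite N" using insert.hyps by (simp add: N_def)
  have dD: "card N \<le> D" using deg'[of v] by (simp add: N_def)
  have e: "card (cliques adj 2 (insert v V)) = card (cliques adj 2 V) + card N"
    using card_cliques_insert[OF insert.hyps sym, of 1] card_cliques_1[of adj N]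
    by (simp add: N_def numeral_2_eq_2)
  have t: "card (cliques adj 3 (insert v V)) = card (cliques adj 3 V) + card (cliques adj 2 N)"
    using card_cliques_insert[OF insert.hyps sym, of 2] by (simp add: N_def)
  let ?f = "real q - real (card N) +
    (real (card N choose 2) - real (card (cliques adj 2 N))) / (real q - real D)"
  have "real (card (proper_colourings (insert v V) adj q)) \<le> real (card (proper_colourings V adj q)) * ?f"
    using card_proper_colourings_insert_le[OF insert.hyps sym irr deg'] q
    unfolding N_def by fastforce
  also have "\<dots> \<le> real (card (proper_colourings V adj q)) * (real q *
     exp (- (real (card N) / real q) - (real (card N) / 2 + real (card (cliques adj 2 N))) / (real q)\<^sup>2
       + 7 * real D ^ 3 / real q ^ 3))"
    using dD card_cliques_le[OF finN] q by (intro mult_left_mono vertex_factor_le_exp) auto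
  also have "\<dots> \<le> (real q ^ card V *
    exp (- (real (card (cliques adj 2 V)) / real q)
         - (real (card (cliques adj 2 V)) / 2 + real (card (cliques adj 3 V))) / (real q)\<^sup>2
         + 7 * real D ^ 3 * real (card V) / real q ^ 3)) * (real q *
     exp (- (real (card N) / real q) - (real (card N) / 2 + real (card (cliques adj 2 N))) / (real q)\<^sup>2
       + 7 * real D ^ 3 / real q ^ 3))"
    using deg' by (intro mult_right_mono insert.IH) auto
  also have "\<dots> = real q ^ card (insert v V) *
    exp (- (real (card (cliques adj 2 (insert v V))) / real q)
         - (real (card (cliques adj 2 (insert v V))) / 2 + real (card (cliques adj 3 (insert v V)))) / (real q)\<^sup>2
         + 7 * real D ^ 3 * real (card (insert v V)) / real q ^ 3)"
    unfolding e t using insert.hyps by (simp add: mult_exp_exp add_divide_distrib algebra_simps)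
  finally show ?case .
qed

section \<open>Edges and triangles of the auxiliary graph\<close>

lemma perm_tuplesD: "\<pi> \<in> perm_tuples n m \<Longrightarrow> k \<in> {1..m} \<Longrightarrow> \<pi> k permutes {1..n}"
  by (auto simp: perm_tuples_def)

lemma inv_image_permutes_nsets:
  assumes "p permutes A" "e \<in> nsets A j"
  shows "inv p ` e \<in> nsets A j"
  using assms(2) permutes_image[OF permutes_inv[OF assms(1)]]
    permutes_inj_on[OF permutes_inv[OF assms(1)]]
  by (auto simp: nsets_def card_image)

lemma card_aux_vertices: "card (aux_vertices n m) = m * (n choose 2)"
  by (simp add: aux_vertices_def card_cartesian_product card_nsets)

lemma aux_degree_le:
  assumes \<pi>: "\<pi> \<in> perm_tuples n m"
  shows "card {x \<in> aux_vertices n m. aux_adj \<pi> v x} \<le> 2 * m"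
proof -
  obtain k e where v: "v = (k, e)" by (cases v)
  let ?A = "(\<lambda>l. (l, e)) ` {1..m}" and ?B = "(\<lambda>l. (l, inv (\<pi> l) ` \<pi> k ` e)) ` {1..m}"
  have "{x \<in> aux_vertices n m. aux_adj \<pi> v x} \<subseteq> ?A \<union> ?B"
  proof (clarify)
    fix l e' assume l: "(l, e') \<in> aux_vertices n m" "aux_adj \<pi> v (l, e')" "(l, e') \<notin> ?B"
    then have lm: "l \<in> {1..m}" by (auto simp: aux_vertices_def)
    have "inv (\<pi> l) ` \<pi> l ` e' = e'"
      using permutes_inj[OF perm_tuplesD[OF \<pi> lm]] by (simp add: image_inv_f_f)
    then have "\<pi> k ` e \<noteq> \<pi> l ` e'" using l(3) lm by force
    then show "(l, e') \<in> ?A" using l(2) lm by (auto simp: aux_adj_def v)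
  qed
  then have "card {x \<in> aux_vertices n m. aux_adj \<pi> v x} \<le> card (?A \<union> ?B)"
    by (intro card_mono) auto
  also have "\<dots> \<le> card ?A + card ?B" by (rule card_Un_le)
  also have "\<dots> \<le> m + m"
    using card_image_le[of "{1..m}" "\<lambda>l. (l, e)"]
      card_image_le[of "{1..m}" "\<lambda>l. (l, inv (\<pi> l) ` \<pi> k ` e)"]
    by (intro add_mono) auto
  finally show ?thesis by simp
qed

text \<open>The cliques \<open>{(k, e) | k \<in> K}\<close> of size \<open>j\<close> that lie both in a clique of constant \<open>e\<close> and in one of
  constant \<open>\<pi> k ` e\<close>, encoded by \<open>(e, K)\<close>.\<close>

definition coincidences :: "nat \<Rightarrow> nat \<Rightarrow> (nat \<Rightarrow> nat \<Rightarrow> nat) \<Rightarrow> nat \<Rightarrow> (nat set \<times> nat set) set" where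
  "coincidences n m \<pi> j =
     {(e, K). e \<in> nsets {1..n} 2 \<and> K \<in> nsets {1..m} j \<and> (\<forall>k\<in>K. \<forall>l\<in>K. \<pi> k ` e = \<pi> l ` e)}"

lemma finite_coincidences: "finite (coincidences n m \<pi> j)"
  by (rule finite_subset[of _ "nsets {1..n} 2 \<times> nsets {1..m} j"])
    (auto simp: coincidences_def finite_imp_finite_nsets)

text \<open>Both families of cliques have this form, with \<open>g k e = e\<close> and with \<open>g k e\<close> the preimage of \<open>e\<close>
  under \<open>\<pi> k\<close>. Without \<open>0 < j\<close> the empty set \<open>K\<close> would forget \<open>e\<close>.\<close>

lemma inj_on_layered_sets:
  assumes "0 < j" "\<And>k. k \<in> A \<Longrightarrow> inj_on (g k) X"
  shows "inj_on (\<lambda>(e, K). (\<lambda>k. (k, g k e)) ` K) (X \<times> nsets A j)"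
proof (rule inj_onI, clarify)
  fix e K e' K'
  assume e: "e \<in> X" "e' \<in> X" and K: "K \<in> nsets A j" "K' \<in> nsets A j"
    and eq: "(\<lambda>k. (k, g k e)) ` K = (\<lambda>k. (k, g k e')) ` K'"
  have "K = fst ` ((\<lambda>k. (k, g k e)) ` K)" by (simp add: image_image)
  also have "\<dots> = K'" unfolding eq by (simp add: image_image)
  finally have KK: "K = K'" .
  obtain k where k: "k \<in> K" using K(1) assms(1) by (fastforce simp: nsets_def)
  have "g k e = g k e'" using k eq by auto
  then show "e = e' \<and> K = K'"
    using KK e k K(1) assms(2) by (auto simp: nsets_def inj_on_def)
qed

text \<open>Inclusion-exclusion for the two families: each has \<open>(n choose 2) * (m choose j)\<close> members, and a
  common member is a coincidence.\<close>

lemma card_aux_cliques_ge: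
  assumes \<pi>: "\<pi> \<in> perm_tuples n m" and j: "0 < j"
  shows "2 * ((n choose 2) * (m choose j)) \<le>
    card (cliques (aux_adj \<pi>) j (aux_vertices n m)) + card (coincidences n m \<pi> j)"
proof -
  let ?X = "nsets {1..n} 2 \<times> nsets {1..m} j"
  let ?F = "\<lambda>g::nat \<Rightarrow> nat set \<Rightarrow> nat set. (\<lambda>(e, K). (\<lambda>k. (k, g k e)) ` K)"
  let ?id = "\<lambda>k e. e" and ?g = "\<lambda>k e. inv (\<pi> k) ` e"
  let ?C = "cliques (aux_adj \<pi>) j (aux_vertices n m)"
  have finX: "finite ?X" by (simp add: finite_imp_finite_nsets)
  have cardX: "card ?X = (n choose 2) * (m choose j)" by (simp add: card_cartesian_product card_nsets)
  have inv_inj: "inj (inv (\<pi> k))" if "k \<in> {1..m}" for k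
    using permutes_inj[OF permutes_inv[OF perm_tuplesD[OF \<pi> that]]] .
  have undo: "\<pi> k ` inv (\<pi> k) ` e = e" if "k \<in> {1..m}" for k e
    using permutes_surj[OF perm_tuplesD[OF \<pi> that]] by (simp add: image_f_inv_f)
  have sub: "?F g ` ?X \<subseteq> ?C"
    if g: "\<And>k e. k \<in> {1..m} \<Longrightarrow> e \<in> nsets {1..n} 2 \<Longrightarrow> g k e \<in> nsets {1..n} 2"
      and adj: "\<And>k l e. k \<in> {1..m} \<Longrightarrow> l \<in> {1..m} \<Longrightarrow> k \<noteq> l \<Longrightarrow> e \<in> nsets {1..n} 2 \<Longrightarrow>
        aux_adj \<pi> (k, g k e) (l, g l e)" for g
  proof (rule image_subsetI, clarify)
    fix e K assume e: "e \<in> nsets {1..n} 2" and K: "K \<in> nsets {1..m} j"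
    have "card ((\<lambda>k. (k, g k e)) ` K) = j"
      using K by (subst card_image) (auto simp: inj_on_def nsets_def)
    moreover have "K \<subseteq> {1..m}" "finite K" using K by (auto simp: nsets_def)
    ultimately show "(\<lambda>k. (k, g k e)) ` K \<in> ?C"
      using g[OF _ e] adj[OF _ _ _ e]
      unfolding cliques_def aux_vertices_def nsets_def[of _ j] by blast
  qed
  have subA: "?F ?id ` ?X \<subseteq> ?C" by (rule sub) (auto simp: aux_adj_def)
  have subB: "?F ?g ` ?X \<subseteq> ?C"
    using inv_image_permutes_nsets[OF perm_tuplesD[OF \<pi>]] undo
    by (intro sub) (auto simp: aux_adj_def)
  have cardA: "card (?F ?id ` ?X) = card ?X"
    by (rule card_image[OF inj_on_layered_sets[OF j]]) auto
  have cardB: "card (?F ?g ` ?X) = card ?X"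
    by (rule card_image[OF inj_on_layered_sets[OF j]], rule inj_onI) (metis inj_image_eq_iff inv_inj)
  have "?F ?id ` ?X \<inter> ?F ?g ` ?X \<subseteq> ?F ?id ` coincidences n m \<pi> j"
  proof (rule subsetI)
    fix S assume "S \<in> ?F ?id ` ?X \<inter> ?F ?g ` ?X"
    then obtain e K f K' where e: "e \<in> nsets {1..n} 2" and K: "K \<in> nsets {1..m} j"
      and S: "S = (\<lambda>k. (k, e)) ` K" and eq: "(\<lambda>k. (k, e)) ` K = (\<lambda>k. (k, inv (\<pi> k) ` f)) ` K'"
      by auto
    have "\<pi> k ` e = f" if "k \<in> K" for k
    proof -
      have "e = inv (\<pi> k) ` f" using that eq by (auto simp: set_eq_iff image_iff)
      moreover have "k \<in> {1..m}" using that K by (auto simp: nsets_def)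
      ultimately show ?thesis using undo by simp
    qed
    then have "(e, K) \<in> coincidences n m \<pi> j" using e K by (auto simp: coincidences_def)
    then show "S \<in> ?F ?id ` coincidences n m \<pi> j"
      by (rule rev_image_eqI) (simp add: S)
  qed
  then have "card (?F ?id ` ?X \<inter> ?F ?g ` ?X) \<le> card (coincidences n m \<pi> j)"
    by (intro surj_card_le[where f = "?F ?id"]) (auto simp: finite_coincidences)
  moreover have "card (?F ?id ` ?X) + card (?F ?g ` ?X) =
      card (?F ?id ` ?X \<union> ?F ?g ` ?X) + card (?F ?id ` ?X \<inter> ?F ?g ` ?X)"
    using finX by (intro card_Un_Int) auto
  moreover have "card (?F ?id ` ?X \<union> ?F ?g ` ?X) \<le> card ?C"
    using subA subB by (intro card_mono) (auto simp: finite_cliques finite_aux_vertices)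
  ultimately show ?thesis unfolding cardA cardB cardX by linarith
qed

text \<open>Double counting of the pairs of a coincidence of size \<open>j + 1\<close> and one of its layers: dropping that layer
  leaves a coincidence of size \<open>j\<close> and a layer outside it, which determine the pair.\<close>

lemma card_coincidences_Suc_le:
  "Suc j * card (coincidences n m \<pi> (Suc j)) \<le> (m - j) * card (coincidences n m \<pi> j)"
proof -
  let ?S = "Sigma (coincidences n m \<pi> (Suc j)) snd"
  let ?T = "Sigma (coincidences n m \<pi> j) (\<lambda>p. {1..m} - snd p)"
  let ?f = "\<lambda>((e, K), k). ((e, K - {k}), k)"
  have layers: "snd p \<subseteq> {1..m} \<and> finite (snd p) \<and> card (snd p) = i"
    if "p \<in> coincidences n m \<pi> i" for p i
  proof -
    have "snd p \<in> nsets {1..m} i" using that unfolding coincidences_def by auto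
    then show ?thesis unfolding nsets_def by simp
  qed
  have "Suc j * card (coincidences n m \<pi> (Suc j)) = card ?S"
    using layers by (subst card_SigmaI) (simp_all add: finite_coincidences)
  also have "\<dots> \<le> card ?T"
  proof (rule card_inj_on_le[of ?f])
    show "inj_on ?f ?S"
      by (rule inj_on_inverseI[where g = "\<lambda>((e, K), k). ((e, insert k K), k)"])
        (auto simp: insert_absorb)
    show "?f ` ?S \<subseteq> ?T"
    proof (rule image_subsetI)
      fix x assume "x \<in> ?S"
      then obtain e K k where x: "x = ((e, K), k)"
        and eK: "(e, K) \<in> coincidences n m \<pi> (Suc j)" and k: "k \<in> K"
        by (metis SigmaE prod.collapse)
      have "K - {k} \<in> nsets {1..m} j" using layers[OF eK] k by (auto simp: nsets_def)
      then have "(e, K - {k}) \<in> coincidences n m \<pi> j"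
        using eK unfolding coincidences_def by blast
      then show "?f x \<in> ?T" using layers[OF eK] k by (auto simp: x)
    qed
    show "finite ?T" by (intro finite_SigmaI finite_coincidences) auto
  qed
  also have "card ?T = (m - j) * card (coincidences n m \<pi> j)"
    using layers by (subst card_SigmaI) (simp_all add: finite_coincidences card_Diff_subset)
  finally show ?thesis .
qed

text \<open>A 2-set mapped to itself has its points either both fixed or exchanged.\<close>

lemma card_fixed_pairs:
  "card {e \<in> nsets {1..n} 2. \<tau> ` e = e} = (fixpts n \<tau> choose 2) + two_cycles n \<tau>"
proof -
  let ?F = "nsets {x \<in> {1..n}. \<tau> x = x} 2"
  let ?C = "{{u, v} | u v. u \<in> {1..n} \<and> v \<in> {1..n} \<and> u \<noteq> v \<and> \<tau> u = v \<and> \<tau> v = u}"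
  have "{e \<in> nsets {1..n} 2. \<tau> ` e = e} = ?F \<union> ?C"
  proof (intro set_eqI iffI)
    fix e assume e: "e \<in> {e \<in> nsets {1..n} 2. \<tau> ` e = e}"
    then obtain u v where uv: "e = {u, v}" "u \<noteq> v" by (auto simp: nsets_def card_2_iff)
    have mem: "u \<in> {1..n}" "v \<in> {1..n}" using e uv by (auto simp: nsets_def)
    consider "\<tau> u = u" "\<tau> v = v" | "\<tau> u = v" "\<tau> v = u"
      using e uv by (auto simp: doubleton_eq_iff)
    then show "e \<in> ?F \<union> ?C"
    proof cases
      case 1
      then have "e \<in> ?F" using uv mem by (simp add: nsets_def)
      then show ?thesis ..
    next
      case 2
      then have "e \<in> ?C" using uv mem by (intro CollectI exI[of _ u] exI[of _ v] conjI)
      then show ?thesis ..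
    qed
  next
    fix e assume "e \<in> ?F \<union> ?C"
    then show "e \<in> {e \<in> nsets {1..n} 2. \<tau> ` e = e}"
    proof
      assume "e \<in> ?F"
      then show ?thesis by (auto simp: nsets_def subset_iff image_iff)
    next
      assume "e \<in> ?C"
      then obtain u v where "e = {u, v}" "u \<in> {1..n}" "v \<in> {1..n}" "u \<noteq> v" "\<tau> u = v" "\<tau> v = u"
        by blast
      then show ?thesis by (simp add: nsets_def insert_commute)
    qed
  qed
  moreover have "?F \<inter> ?C = {}"
  proof (rule ccontr)
    assume "?F \<inter> ?C \<noteq> {}"
    then obtain u v where "{u, v} \<in> ?F" "u \<noteq> v" "\<tau> u = v" by blast
    then show False by (simp add: nsets_def)
  qed
  moreover have "finite ?C" by (rule finite_subset[of _ "Pow {1..n}"]) auto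
  ultimately show ?thesis
    by (simp add: card_Un_disjoint finite_imp_finite_nsets card_nsets fixpts_def two_cycles_def)
qed

text \<open>A coincidence of the layers \<open>k < l\<close> at \<open>e\<close> says that \<open>e\<close> is fixed by \<open>inv (\<pi> k) \<circ> \<pi> l\<close>.\<close>

lemma card_coincidences_2_le_wt:
  assumes \<pi>: "\<pi> \<in> perm_tuples n m"
  shows "card (coincidences n m \<pi> 2) \<le> wt n m \<pi>"
proof -
  let ?E = "\<lambda>k l. {e \<in> nsets {1..n} 2. (inv (\<pi> k) \<circ> \<pi> l) ` e = e}"
  let ?S = "SIGMA k:{1..m}. SIGMA l:{k<..m}. ?E k l"
  have finE: "finite (?E k l)" for k l by (simp add: finite_imp_finite_nsets)
  have "card (coincidences n m \<pi> 2) \<le> card ?S"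
  proof (rule surj_card_le[where f = "\<lambda>(k, l, e). (e, {k, l})"])
    show "finite ?S" using finE by (intro finite_SigmaI) auto
    show "coincidences n m \<pi> 2 \<subseteq> (\<lambda>(k, l, e). (e, {k, l})) ` ?S"
    proof (clarify)
      fix e K assume eK: "(e, K) \<in> coincidences n m \<pi> 2"
      then have "card K = 2" and Km: "K \<subseteq> {1..m}" by (auto simp: coincidences_def nsets_def)
      then obtain a b where ab: "K = {a, b}" "a \<noteq> b" by (auto simp: card_2_iff)
      then have "\<exists>k l. K = {k, l} \<and> k < l"
        by (metis insert_commute linorder_neqE_nat)
      then obtain k l where K: "K = {k, l}" "k < l" by blast
      then have kl: "K = {k, l}" "k < l" "k \<in> {1..m}" "l \<in> {1..m}" using Km by simp_all
      have "\<forall>k\<in>K. \<forall>l\<in>K. \<pi> k ` e = \<pi> l ` e" and e: "e \<in> nsets {1..n} 2"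
        using eK unfolding coincidences_def by blast+
      then have "\<pi> l ` e = \<pi> k ` e" using kl(1) by blast
      then have "(inv (\<pi> k) \<circ> \<pi> l) ` e = inv (\<pi> k) ` \<pi> k ` e"
        by (metis image_comp)
      also have "\<dots> = e"
        using permutes_inj[OF perm_tuplesD[OF \<pi> kl(3)]] by (simp add: image_inv_f_f)
      finally have "(k, l, e) \<in> ?S" using e kl by simp
      then show "(e, K) \<in> (\<lambda>(k, l, e). (e, {k, l})) ` ?S"
        by (rule rev_image_eqI) (simp add: kl)
    qed
  qed
  also have "card ?S = (\<Sum>k\<in>{1..m}. \<Sum>l\<in>{k<..m}. card (?E k l))"
    using finE by (simp add: card_SigmaI)
  also have "\<dots> = wt n m \<pi>"
    unfolding wt_def wt_pair_def Let_def
    by (intro sum.cong refl card_fixed_pairs)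
  finally show ?thesis .
qed

section \<open>The exponential bound for the auxiliary graph\<close>

lemma sum_of_nat_eq_choose: "(\<Sum>i<m. real i) = real (m choose 2)"
  by (induction m) (simp_all add: numeral_2_eq_2)

lemma real_square_eq_choose: "(real m)\<^sup>2 = real m + 2 * real (m choose 2)"
  by (induction m) (simp_all add: numeral_2_eq_2 power2_eq_square algebra_simps)

lemma sum_squares_eq_choose: "(\<Sum>i<m. (real i)\<^sup>2) = real (m choose 2) + 2 * real (m choose 3)"
proof (induction m)
  case (Suc m)
  have "Suc m choose 2 = m + (m choose 2)" "Suc m choose 3 = (m choose 2) + (m choose 3)"
    by (simp_all add: numeral_2_eq_2 numeral_3_eq_3)
  then show ?case using Suc by (simp add: real_square_eq_choose)
qed (simp add: binomial_eq_0)

text \<open>Summing \<open>ln (1 - x) \<ge> - x - x^2 / 2 - x^3\<close> over \<open>x = i / r\<close>, with the power sums written as binomial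
  coefficients so that they match clique numbers.\<close>

lemma E_const_ge_exp:
  assumes "2 * m \<le> r" "0 < r"
  shows "exp (- (real (n choose 2) * (real (m choose 2) / real r
      + (real (m choose 2) / 2 + real (m choose 3)) / (real r)\<^sup>2 + (\<Sum>i<m. real i ^ 3) / real r ^ 3)))
    \<le> E_const n m r"
proof -
  let ?N = "n choose 2"
  let ?g = "\<lambda>i. real i / real r"
  have "real (m choose 2) / real r
      + (real (m choose 2) / 2 + real (m choose 3)) / (real r)\<^sup>2 + (\<Sum>i<m. real i ^ 3) / real r ^ 3
      = (\<Sum>i<m. ?g i + (?g i)\<^sup>2 / 2 + ?g i ^ 3)"
    unfolding sum.distrib power_divide sum_divide_distrib[symmetric]
      sum_of_nat_eq_choose sum_squares_eq_choose by (simp add: field_simps)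
  then have "exp (- (real ?N * (real (m choose 2) / real r
      + (real (m choose 2) / 2 + real (m choose 3)) / (real r)\<^sup>2 + (\<Sum>i<m. real i ^ 3) / real r ^ 3)))
     = (\<Prod>i<m. exp (- (?g i + (?g i)\<^sup>2 / 2 + ?g i ^ 3))) ^ ?N"
    by (simp only: exp_sum[symmetric] exp_of_nat_mult[symmetric] sum_negf finite_lessThan mult_minus_right)
  also have "\<dots> \<le> (\<Prod>i<m. 1 - ?g i) ^ ?N"
    using assms by (intro power_mono prod_mono conjI exp_minus_cubic_le_one_minus prod_nonneg)
      (auto simp: field_simps)
  also have "(\<Prod>i<m. 1 - ?g i) = (\<Prod>i=1..m-1. 1 - ?g i)"
    by (rule prod.mono_neutral_right) (auto simp: not_le)
  finally show ?thesis by (simp add: E_const_def prod_power_distrib)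
qed

text \<open>The non-asymptotic form of the result. Degrees are at most \<open>2 * m\<close>, so the third-order error of
  \<open>m N\<close> vertices is \<open>7 (2 m)^3 m N / r^3 = 56 m^4 N / r^3\<close>; the power sum of cubes comes from the
  square of \<open>E_const\<close>.\<close>

lemma chromatic_poly_aux_le:
  assumes \<pi>: "\<pi> \<in> perm_tuples n m" and m: "2 \<le> m" and r: "4 * m \<le> r"
  shows "poly (chromatic_poly (aux_vertices n m) (aux_adj \<pi>)) (real r) \<le>
    exp ((56 * real m ^ 4 + 2 * (\<Sum>i<m. real i ^ 3)) * (real (n choose 2) / real r ^ 3)) *
    real r ^ (m * (n choose 2)) * (E_const n m r)\<^sup>2 * exp (real (wt n m \<pi>) / (real r - c_const m))"
proof -
  define N where "N = real (n choose 2)"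
  define R where "R = real r"
  define W where "W = real (wt n m \<pi>)"
  define c where "c = c_const m"
  define e where "e = real (card (cliques (aux_adj \<pi>) 2 (aux_vertices n m)))"
  define t where "t = real (card (cliques (aux_adj \<pi>) 3 (aux_vertices n m)))"
  define b2 where "b2 = real (m choose 2)"
  define b3 where "b3 = real (m choose 3)"
  define s3 where "s3 = (\<Sum>i<m. real i ^ 3)"
  define D where "D j = real (card (coincidences n m \<pi> j))" for j
  have r0: "0 < r" using m r by simp
  have R: "0 < R" using r0 by (simp add: R_def)
  have W0: "0 \<le> W" by (simp add: W_def)
  have c: "0 < c" "c < R" "c = 1 / 2 + (real m - 2) / 3"
    using m r by (simp_all add: c_def c_const_def R_def field_simps)
  have D2: "D 2 \<le> W" using card_coincidences_2_le_wt[OF \<pi>] by (simp add: D_def W_def)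
  have "3 * card (coincidences n m \<pi> 3) \<le> (m - 2) * card (coincidences n m \<pi> 2)"
    using card_coincidences_Suc_le[of 2 n m \<pi>] by simp
  then have "real (3 * card (coincidences n m \<pi> 3)) \<le> real ((m - 2) * card (coincidences n m \<pi> 2))"
    by (simp only: of_nat_le_iff)
  then have "3 * D 3 \<le> (real m - 2) * D 2"
    using m by (simp add: D_def of_nat_diff)
  also have "\<dots> \<le> (real m - 2) * W" using D2 m by (intro mult_left_mono) auto
  finally have D3: "D 3 \<le> (real m - 2) / 3 * W" by simp
  have e: "2 * N * b2 - W \<le> e"
    using of_nat_mono[OF card_aux_cliques_ge[OF \<pi>, of 2], where 'a = real] D2
    by (simp add: D_def N_def b2_def e_def)
  have "2 * N * b3 - D 3 \<le> t"
    using of_nat_mono[OF card_aux_cliques_ge[OF \<pi>, of 3], where 'a = real]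
    by (simp add: D_def N_def b3_def t_def)
  then have t: "2 * N * b3 - (real m - 2) / 3 * W \<le> t" using D3 by linarith
  \<comment> \<open>The value of \<open>c\<close> is what the edge deficit, halved, and the triangle deficit add up to.\<close>
  have "e / 2 + t \<ge> 2 * N * (b2 / 2 + b3) - c * W"
    using e t unfolding c(3) by (simp add: algebra_simps)
  then have "- (e / R) - (e / 2 + t) / R\<^sup>2 \<le>
      - ((2 * N * b2 - W) / R) - (2 * N * (b2 / 2 + b3) - c * W) / R\<^sup>2"
    using e R by (intro diff_mono divide_right_mono le_imp_neg_le) auto
  also have "\<dots> = - (2 * N * (b2 / R + (b2 / 2 + b3) / R\<^sup>2)) + (W / R + c * W / R\<^sup>2)"
    using R by (simp add: field_simps)
  also have "W / R + c * W / R\<^sup>2 \<le> W / (R - c)"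
  proof -
    have "1 / R + c / R\<^sup>2 \<le> 1 / R + c / R\<^sup>2 + c\<^sup>2 / (R\<^sup>2 * (R - c))"
      using c R by simp
    also have "\<dots> = 1 / (R - c)"
      using c R by (simp add: divide_simps) (simp add: power2_eq_square algebra_simps)
    finally have "1 / R + c / R\<^sup>2 \<le> 1 / (R - c)" .
    from mult_left_mono[OF this W0] show ?thesis by (simp add: distrib_left mult.commute)
  qed
  finally have main: "- (e / R) - (e / 2 + t) / R\<^sup>2 \<le>
      - (2 * N * (b2 / R + (b2 / 2 + b3) / R\<^sup>2)) + W / (R - c)" by simp
  have "symp (aux_adj \<pi>)" "irreflp (aux_adj \<pi>)"
    using aux_adj_sym aux_adj_irrefl by (auto intro!: sympI irreflpI)
  then have bound: "real (card (proper_colourings (aux_vertices n m) (aux_adj \<pi>) r)) \<le>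
     real r ^ card (aux_vertices n m) * exp (- (e / R) - (e / 2 + t) / R\<^sup>2
       + 7 * real (2 * m) ^ 3 * real (card (aux_vertices n m)) / R ^ 3)"
    unfolding e_def t_def R_def
    using r r0 by (intro card_proper_colourings_le_exp finite_aux_vertices aux_degree_le[OF \<pi>]) auto
  have error: "7 * real (2 * m) ^ 3 * real (card (aux_vertices n m)) / R ^ 3 =
      56 * real m ^ 4 * (N / R ^ 3)"
    unfolding card_aux_vertices
    by (simp add: N_def power_mult_distrib power3_eq_cube power4_eq_xxxx)
  have "poly (chromatic_poly (aux_vertices n m) (aux_adj \<pi>)) R \<le>
     R ^ (m * (n choose 2)) * exp (- (e / R) - (e / 2 + t) / R\<^sup>2 + 56 * real m ^ 4 * (N / R ^ 3))"
    using bound unfolding error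
    unfolding card_aux_vertices R_def poly_chromatic_poly[OF finite_aux_vertices] .
  also have "\<dots> \<le> R ^ (m * (n choose 2)) *
      exp (- (2 * N * (b2 / R + (b2 / 2 + b3) / R\<^sup>2)) + W / (R - c) + 56 * real m ^ 4 * (N / R ^ 3))"
    using main R by simp
  also have "- (2 * N * (b2 / R + (b2 / 2 + b3) / R\<^sup>2)) + W / (R - c)
      + 56 * real m ^ 4 * (N / R ^ 3) =
      (56 * real m ^ 4 + 2 * s3) * (N / R ^ 3)
      + 2 * - (N * (b2 / R + (b2 / 2 + b3) / R\<^sup>2 + s3 / R ^ 3)) + W / (R - c)"
    by (simp add: distrib_left distrib_right add_divide_distrib)
  also have "R ^ (m * (n choose 2)) * exp ((56 * real m ^ 4 + 2 * s3) * (N / R ^ 3)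
      + 2 * - (N * (b2 / R + (b2 / 2 + b3) / R\<^sup>2 + s3 / R ^ 3)) + W / (R - c)) =
      exp ((56 * real m ^ 4 + 2 * s3) * (N / R ^ 3)) * R ^ (m * (n choose 2)) *
      (exp (- (N * (b2 / R + (b2 / 2 + b3) / R\<^sup>2 + s3 / R ^ 3))))\<^sup>2 * exp (W / (R - c))"
    unfolding exp_add exp_double by (simp only: mult_ac)
  also have "\<dots> \<le> exp ((56 * real m ^ 4 + 2 * s3) * (N / R ^ 3)) * R ^ (m * (n choose 2)) *
      (E_const n m r)\<^sup>2 * exp (W / (R - c))"
    using E_const_ge_exp[of m r n] r r0 R unfolding N_def R_def b2_def b3_def s3_def
    by (intro mult_right_mono mult_left_mono power_mono) auto
  finally show ?thesis unfolding N_def R_def s3_def W_def c_def .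
qed

theorem proposition3p2:
  fixes m :: nat and r :: "nat \<Rightarrow> nat"
  assumes "m \<ge> 2"
    and "\<And>n. r n > 0"
    and "(\<lambda>n. real (n choose 2) / real (r n) ^ 3) \<longlonglongrightarrow> 0"
  shows "\<exists>\<epsilon> :: nat \<Rightarrow> real. \<epsilon> \<longlonglongrightarrow> 0 \<and>
    (\<forall>\<^sub>F n in sequentially. \<forall>\<pi> \<in> perm_tuples n m.
       poly (chromatic_poly (aux_vertices n m) (aux_adj \<pi>)) (real (r n))
         \<le> (1 + \<epsilon> n) * real (r n) ^ (m * (n choose 2)) * (E_const n m (r n))\<^sup>2
             * exp (real (wt n m \<pi>) / (real (r n) - c_const m)))"
proof -
  define C where "C = 56 * real m ^ 4 + 2 * (\<Sum>i<m. real i ^ 3)"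
  define \<epsilon> where "\<epsilon> n = exp (C * (real (n choose 2) / real (r n) ^ 3)) - 1" for n
  have "\<epsilon> \<longlonglongrightarrow> exp (C * 0) - 1"
    unfolding \<epsilon>_def by (intro tendsto_intros assms(3))
  then have lim: "\<epsilon> \<longlonglongrightarrow> 0" by simp
  \<comment> \<open>As \<open>n choose 2 \<ge> 1\<close> for \<open>n \<ge> 2\<close>, the hypothesis forces \<open>r n\<close> to infinity.\<close>
  have "\<forall>\<^sub>F n in sequentially. real (n choose 2) / real (r n) ^ 3 < 1 / real (4 * m) ^ 3"
    using assms(1) by (intro order_tendstoD(2)[OF assms(3)]) simp
  then have "\<forall>\<^sub>F n in sequentially. 4 * m \<le> r n"
    using eventually_ge_at_top[of 2]
  proof eventually_elim
    case (elim n)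
    have "1 \<le> real (n choose 2)" using elim(2) by (simp add: Suc_le_eq)
    then have "1 / real (r n) ^ 3 \<le> real (n choose 2) / real (r n) ^ 3"
      by (intro divide_right_mono) auto
    then have "1 / real (r n) ^ 3 < 1 / real (4 * m) ^ 3" using elim(1) by linarith
    then have "real (4 * m) ^ 3 < real (r n) ^ 3"
      using assms(1) assms(2)[of n] by (simp add: field_simps)
    then have "real (4 * m) < real (r n)" by (rule power_less_imp_less_base) simp
    then show ?case by linarith
  qed
  then have "\<forall>\<^sub>F n in sequentially. \<forall>\<pi> \<in> perm_tuples n m.
       poly (chromatic_poly (aux_vertices n m) (aux_adj \<pi>)) (real (r n))
         \<le> (1 + \<epsilon> n) * real (r n) ^ (m * (n choose 2)) * (E_const n m (r n))\<^sup>2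
             * exp (real (wt n m \<pi>) / (real (r n) - c_const m))"
  proof (eventually_elim, intro ballI)
    fix n \<pi> assume "4 * m \<le> r n" "\<pi> \<in> perm_tuples n m"
    then show "poly (chromatic_poly (aux_vertices n m) (aux_adj \<pi>)) (real (r n))
        \<le> (1 + \<epsilon> n) * real (r n) ^ (m * (n choose 2)) * (E_const n m (r n))\<^sup>2
          * exp (real (wt n m \<pi>) / (real (r n) - c_const m))"
      using chromatic_poly_aux_le[of \<pi> n m "r n"] assms(1)
      unfolding \<epsilon>_def C_def add_diff_cancel_left' add.commute[of 1] diff_add_cancel by blast
  qed
  then show ?thesis using lim by blast
qed

end
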